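(* Let $N \ge 1$ be an integer and let $\Lambda = (\lambda_1,\dots,\lambda_N)$ and $D = (d_1,\dots,d_N)$ be two sequences of $N$ complex numbers. There exists an $N\times N$ complex matrix $A$ with eigenvalue sequence $\Lambda$ and diagonal sequence $D$ if and only if $$\sum_{j=1}^N \lambda_j = \sum_{j=1}^N d_j .$$ Indeed, under this condition, there exists an $N\times N$ (complex) unit lower triangular matrix $L$ such that the diagonal sequence of $L^{-1}[T_\Lambda]L$ is $D$. If $\Lambda$ and $D$ are both real, then $L$ can be taken to be real.
   Context: The diagonal sequence of an $N\times N$ matrix $A$ is $(A_{11},A_{22},\dots,A_{NN})$. That $A$ has eigenvalue sequence $\Lambda=(\lambda_1,\dots,\lambda_N)$ means that $\lambda_1,\dots,\lambda_N$ are the eigenvalues of $A$ listed with algebraic multiplicity (in some order), i.e. the characteristic polynomial of $A$ is $\prod_{j=1}^N (x-\lambda_j)$. For a sequence $\Lambda=(\lambda_1,\dots,\lambda_N)$, $[T_\Lambda]$ denotes the $N\times N$ matrix that has $\Lambda$ as its diagonal sequence, has $1$ in every entry immediately above the diagonal (positions $(i,i+1)$, $1\le i\le N-1$), and has $0$ in all remaining entries. A unit lower triangular matrix is a square matrix in which every entry on the diagonal is $1$ and every entry above the diagonal is $0$. Such matrices are invertible. *)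

theory Defs
  imports "Jordan_Normal_Form.Char_Poly"
begin

text \<open>
  Sequences of length \<open>N\<close> are lists of length \<open>N\<close>; indices start at \<open>0\<close>.
\<close>

definition has_eigenvalue_seq :: "'a :: comm_ring_1 mat \<Rightarrow> 'a list \<Rightarrow> bool" where
  "has_eigenvalue_seq A \<Lambda> \<longleftrightarrow> char_poly A = (\<Prod>x\<leftarrow>\<Lambda>. [:- x, 1:])"

definition T_mat :: "'a :: {zero, one} list \<Rightarrow> 'a mat" where
  "T_mat \<Lambda> = mat (length \<Lambda>) (length \<Lambda>)
     (\<lambda>(i, j). if i = j then \<Lambda> ! i else if j = Suc i then 1 else 0)"

definition unit_lower_triangular :: "'a :: {zero, one} mat \<Rightarrow> bool" where
  "unit_lower_triangular A \<longleftrightarrow> square_mat A \<and>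
     (\<forall>i < dim_row A. A $$ (i, i) = 1) \<and>
     (\<forall>i < dim_row A. \<forall>j < dim_col A. i < j \<longrightarrow> A $$ (i, j) = 0)"

end

theory Submission
  imports Defs "Jordan_Normal_Form.Schur_Decomposition"
begin

text \<open>
  Necessity is invariance of the trace under similarity, applied to a Schur triangularisation.
  For the construction, only the first subdiagonal of \<open>L\<close> matters: if its entries are
  \<open>c\<^sub>0, c\<^sub>1, \<dots>\<close>, then the diagonal of \<open>L\<^sup>-\<^sup>1 T L\<close> is
  \<open>\<lambda>\<^sub>j + c\<^sub>j - c\<^sub>j\<^sub>-\<^sub>1\<close>. So one takes \<open>L\<close> bidiagonal with \<open>c\<^sub>j\<close> the partial sums
  of \<open>D - \<Lambda>\<close>; the trace condition says that the last partial sum vanishes, which is what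
  the last diagonal entry requires.
\<close>

lemma sum_list_diag_mat: "sum_list (diag_mat A) = (\<Sum>i<dim_row A. A $$ (i, i))"
  by (simp add: diag_mat_def interv_sum_list_conv_sum_set_nat atLeast0LessThan)

lemma index_mult_mat_sum:
  assumes "A \<in> carrier_mat n m" "B \<in> carrier_mat m p" "i < n" "j < p"
  shows "(A * B) $$ (i, j) = (\<Sum>k<m. A $$ (i, k) * B $$ (k, j))"
  using assms by (simp add: scalar_prod_def atLeast0LessThan)

lemma sum_list_diag_mult_commute:
  fixes A B :: "'a :: comm_semiring_0 mat"
  assumes "A \<in> carrier_mat n m" "B \<in> carrier_mat m n"
  shows "sum_list (diag_mat (A * B)) = sum_list (diag_mat (B * A))"
proof -
  have "sum_list (diag_mat (A * B)) = (\<Sum>i<n. \<Sum>k<m. A $$ (i, k) * B $$ (k, i))"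
    using assms by (simp add: sum_list_diag_mat index_mult_mat_sum del: index_mult_mat(1))
  also have "\<dots> = (\<Sum>k<m. \<Sum>i<n. B $$ (k, i) * A $$ (i, k))"
    by (subst sum.swap) (simp add: mult.commute)
  also have "\<dots> = sum_list (diag_mat (B * A))"
    using assms by (simp add: sum_list_diag_mat index_mult_mat_sum del: index_mult_mat(1))
  finally show ?thesis .
qed

lemma sum_list_diag_similar:
  fixes A B :: "'a :: comm_ring_1 mat"
  assumes "similar_mat A B"
  shows "sum_list (diag_mat A) = sum_list (diag_mat B)"
proof -
  obtain n P Q where carr: "A \<in> carrier_mat n n" "B \<in> carrier_mat n n"
      "P \<in> carrier_mat n n" "Q \<in> carrier_mat n n"
    and QP: "Q * P = 1\<^sub>m n" and A: "A = P * B * Q"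
    using similar_matD[OF assms] by auto
  have "sum_list (diag_mat A) = sum_list (diag_mat (Q * (P * B)))"
    unfolding A using carr by (intro sum_list_diag_mult_commute[of _ n n]) auto
  also have "Q * (P * B) = B"
    using carr by (simp flip: assoc_mult_mat[of Q n n P n B n] add: QP)
  finally show ?thesis .
qed

lemma sum_list_diag_eq_eigenvalues:
  fixes A :: "'a :: conjugatable_ordered_field mat"
  assumes A: "A \<in> carrier_mat n n" and "has_eigenvalue_seq A \<Lambda>"
  shows "sum_list (diag_mat A) = sum_list \<Lambda>"
proof -
  obtain B P Q where schur: "schur_decomposition A \<Lambda> = (B, P, Q)"
    by (cases "schur_decomposition A \<Lambda>") auto
  \<comment> \<open>The Schur form is computed from a given listing of the eigenvalues and keeps its
    order on the diagonal, so that diagonal is the list \<Lambda> itself.\<close>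
  have "similar_mat A B" "diag_mat B = \<Lambda>"
    using schur_decomposition[OF A _ schur] assms(2)
    by (auto simp: has_eigenvalue_seq_def similar_mat_def)
  then show ?thesis
    using sum_list_diag_similar by metis
qed

text \<open>The subdiagonal is indexed by column: \<open>c j\<close> sits in row
  \<open>Suc j\<close>, so only \<open>c 0\<close> to \<open>c (n - 2)\<close> occur.\<close>

definition lower_bidiag :: "nat \<Rightarrow> (nat \<Rightarrow> 'a) \<Rightarrow> 'a :: comm_ring_1 mat" where
  "lower_bidiag n c = mat n n (\<lambda>(i, j). if i = j then 1 else if i = Suc j then c j else 0)"

text \<open>With \<open>S\<close> the strictly lower part of \<open>lower_bidiag n c\<close>, this
  is the terminating Neumann series of 1 + S: the k-th power of -S fills exactly the k-th
  subdiagonal, with products of k consecutive values \<open>- c\<close>. The empty product supplies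
  the diagonal 1.\<close>

definition lower_bidiag_inv :: "nat \<Rightarrow> (nat \<Rightarrow> 'a) \<Rightarrow> 'a :: comm_ring_1 mat" where
  "lower_bidiag_inv n c = mat n n (\<lambda>(i, j). if i < j then 0 else \<Prod>k=j..<i. - c k)"

lemma lower_bidiag_carrier [simp]:
  "lower_bidiag n c \<in> carrier_mat n n" "lower_bidiag_inv n c \<in> carrier_mat n n"
  by (simp_all add: lower_bidiag_def lower_bidiag_inv_def)

lemma lower_bidiag_dim [simp]:
  "dim_row (lower_bidiag n c) = n" "dim_col (lower_bidiag n c) = n"
  "dim_row (lower_bidiag_inv n c) = n" "dim_col (lower_bidiag_inv n c) = n"
  by (simp_all add: lower_bidiag_def lower_bidiag_inv_def)

lemma unit_lower_triangular_lower_bidiag: "unit_lower_triangular (lower_bidiag n c)"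
  by (auto simp: unit_lower_triangular_def lower_bidiag_def)

lemma lower_bidiag_mult_inv: "lower_bidiag n c * lower_bidiag_inv n c = 1\<^sub>m n"
proof (rule eq_matI)
  fix i j assume "i < dim_row (1\<^sub>m n :: 'a mat)" "j < dim_col (1\<^sub>m n :: 'a mat)"
  then have ij: "i < n" "j < n" by auto
  let ?M = "lower_bidiag_inv n c"
  have "(lower_bidiag n c * ?M) $$ (i, j) = (\<Sum>k<n. lower_bidiag n c $$ (i, k) * ?M $$ (k, j))"
    using ij by (intro index_mult_mat_sum) auto
  \<comment> \<open>Row \<open>i\<close> has at most two nonzero entries. Testing
    \<open>Suc k = i\<close> instead of \<open>k = i - 1\<close> makes the second one disappear in
    row 0.\<close>
  also have "\<dots> = (\<Sum>k<n. (if k = i then ?M $$ (i, j) else 0)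
                        + (if Suc k = i then c k * ?M $$ (k, j) else 0))"
    using ij by (intro sum.cong) (auto simp: lower_bidiag_def)
  also have "\<dots> = ?M $$ (i, j) + (\<Sum>k<n. if Suc k = i then c k * ?M $$ (k, j) else 0)"
    using ij by (simp add: sum.distrib)
  also have "\<dots> = 1\<^sub>m n $$ (i, j)"
  proof (cases i)
    case 0
    then show ?thesis using ij by (auto simp: lower_bidiag_inv_def)
  next
    case (Suc m)
    then have "(\<Sum>k<n. if Suc k = i then c k * ?M $$ (k, j) else 0) = c m * ?M $$ (m, j)"
      using ij by simp
    \<comment> \<open>Below the diagonal the product for row \<open>Suc m\<close> is
      \<open>- c m\<close> times the one for row \<open>m\<close>, so the two terms cancel. On the
      diagonal the entry in row \<open>m\<close> is 0 and the empty product 1 remains.\<close>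
    then show ?thesis
      using ij Suc by (auto simp: lower_bidiag_inv_def not_less le_Suc_eq)
  qed
  finally show "(lower_bidiag n c * ?M) $$ (i, j) = 1\<^sub>m n $$ (i, j)" .
qed auto

lemma lower_bidiag_inv_mult:
  "lower_bidiag_inv n c * lower_bidiag n c = 1\<^sub>m n" for c :: "nat \<Rightarrow> 'a :: field"
  by (rule mat_mult_left_right_inverse[OF _ _ lower_bidiag_mult_inv]) auto

lemma T_mat_carrier: "length \<Lambda> = n \<Longrightarrow> T_mat \<Lambda> \<in> carrier_mat n n"
  by (simp add: T_mat_def)

lemma T_mat_mult_index:
  fixes \<Lambda> :: "'a :: comm_ring_1 list"
  assumes "length \<Lambda> = n" "B \<in> carrier_mat n p" "i < n" "j < p"
  shows "(T_mat \<Lambda> * B) $$ (i, j)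
    = \<Lambda> ! i * B $$ (i, j) + (if Suc i < n then B $$ (Suc i, j) else 0)"
proof -
  have "(T_mat \<Lambda> * B) $$ (i, j) = (\<Sum>k<n. T_mat \<Lambda> $$ (i, k) * B $$ (k, j))"
    using assms by (intro index_mult_mat_sum[OF T_mat_carrier]) auto
  also have "\<dots> = (\<Sum>k<n. (if k = i then \<Lambda> ! i * B $$ (i, j) else 0)
                        + (if k = Suc i then B $$ (Suc i, j) else 0))"
    using assms by (intro sum.cong) (auto simp: T_mat_def)
  finally show ?thesis
    using assms by (simp add: sum.distrib)
qed

text \<open>The left factor is lower triangular, and column \<open>j\<close> of
  \<open>T_mat \<Lambda> * lower_bidiag n c\<close> vanishes above row \<open>j - 1\<close>. Hence
  only the summands for \<open>j - 1\<close> and \<open>j\<close> survive, and entries of the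
  inverse further from the diagonal never matter.\<close>

lemma conj_T_mat_diag:
  fixes \<Lambda> :: "'a :: comm_ring_1 list"
  assumes len: "length \<Lambda> = n" and j: "j < n"
  shows "(lower_bidiag_inv n c * T_mat \<Lambda> * lower_bidiag n c) $$ (j, j)
    = \<Lambda> ! j + (if Suc j < n then c j else 0) - (if j = 0 then 0 else c (j - 1))"
proof -
  let ?L = "lower_bidiag n c" and ?K = "lower_bidiag_inv n c"
  let ?M = "T_mat \<Lambda> * ?L"
  have M: "?M \<in> carrier_mat n n"
    using T_mat_carrier[OF len] by auto
  have "?K * T_mat \<Lambda> * ?L = ?K * ?M"
    using T_mat_carrier[OF len] by (intro assoc_mult_mat) auto
  then have "(?K * T_mat \<Lambda> * ?L) $$ (j, j) = (\<Sum>k<n. ?K $$ (j, k) * ?M $$ (k, j))"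
    using j M by (simp add: index_mult_mat_sum[of _ n n _ n] del: index_mult_mat(1))
  also have "\<dots> = (\<Sum>k<n. (if k = j then \<Lambda> ! j + (if Suc j < n then c j else 0) else 0)
                        - (if Suc k = j then c k else 0))"
  proof (intro sum.cong refl)
    fix k assume "k \<in> {..<n}"
    then have k: "k < n" by simp
    have Mkj: "?M $$ (k, j) = \<Lambda> ! k * ?L $$ (k, j) + (if Suc k < n then ?L $$ (Suc k, j) else 0)"
      by (rule T_mat_mult_index[OF len lower_bidiag_carrier(1) k j])
    \<comment> \<open>For \<open>k = j\<close> the left factor is 1. For \<open>Suc k = j\<close> it
      is \<open>- c k\<close>, multiplied by the superdiagonal 1 of \<open>T_mat \<Lambda>\<close>.
      The outer cases give 0.\<close>
    consider "j < k" | "k = j" | "Suc k = j" | "Suc k < j" by linarith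
    then show "?K $$ (j, k) * ?M $$ (k, j)
      = (if k = j then \<Lambda> ! j + (if Suc j < n then c j else 0) else 0)
        - (if Suc k = j then c k else 0)"
      unfolding Mkj using j k
      by cases (auto simp: lower_bidiag_def lower_bidiag_inv_def)
  qed
  also have "\<dots> = \<Lambda> ! j + (if Suc j < n then c j else 0) - (\<Sum>k<n. if Suc k = j then c k else 0)"
    using j by (simp add: sum_subtractf)
  also have "(\<Sum>k<n. if Suc k = j then c k else 0) = (if j = 0 then 0 else c (j - 1))"
    using j by (cases j) auto
  finally show ?thesis .
qed

lemma conj_T_mat_partial_sums:
  fixes \<Lambda> D :: "'a :: comm_ring_1 list"
  assumes len: "length \<Lambda> = n" "length D = n" and tr: "sum_list \<Lambda> = sum_list D"
  defines "c \<equiv> \<lambda>j. \<Sum>k\<le>j. D ! k - \<Lambda> ! k"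
  shows "diag_mat (lower_bidiag_inv n c * T_mat \<Lambda> * lower_bidiag n c) = D"
proof (rule nth_equalityI)
  show "length (diag_mat (lower_bidiag_inv n c * T_mat \<Lambda> * lower_bidiag n c)) = length D"
    using len by (simp add: diag_mat_def)
next
  fix j assume "j < length (diag_mat (lower_bidiag_inv n c * T_mat \<Lambda> * lower_bidiag n c))"
  then have j: "j < n" by (simp add: diag_mat_def)
  \<comment> \<open>The last diagonal entry has no \<open>c j\<close> term. There \<open>c j\<close>
    is the complete sum of the differences, which the trace condition makes 0, so the term may be
    added and all rows obey one formula.\<close>
  have "c j = 0" if "\<not> Suc j < n"
  proof -
    have "{..j} = {0..<n}" using j that by auto
    then show ?thesis
      using tr len by (simp add: c_def sum_subtractf sum_list_sum_nth)
  qed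
  then have "(if Suc j < n then c j else 0) = c j" by simp
  moreover have "c j - (if j = 0 then 0 else c (j - 1)) = D ! j - \<Lambda> ! j"
    by (cases j) (simp_all add: c_def)
  ultimately show "diag_mat (lower_bidiag_inv n c * T_mat \<Lambda> * lower_bidiag n c) ! j = D ! j"
    using j conj_T_mat_diag[OF len(1) j, of c]
    by (simp add: diag_mat_def algebra_simps del: index_mult_mat(1))
qed

lemma has_eigenvalue_seq_T_mat: "has_eigenvalue_seq (T_mat \<Lambda>) \<Lambda>"
proof -
  have "upper_triangular (T_mat \<Lambda>)" "diag_mat (T_mat \<Lambda>) = \<Lambda>"
    by (auto simp: T_mat_def diag_mat_def intro: nth_equalityI)
  then show ?thesis
    using char_poly_upper_triangular[OF T_mat_carrier[OF refl]] by (metis has_eigenvalue_seq_def)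
qed

text \<open>The inverse of \<open>L\<close> appears as a two-sided inverse \<open>Linv\<close>,
  which determines it uniquely. Real matrices are complex matrices with all entries in \<real>, so
  one choice of \<open>L\<close> serves both existence claims.\<close>

theorem theorem1p2:
  fixes N :: nat and \<Lambda> D :: "complex list"
  assumes "N \<ge> 1" and "length \<Lambda> = N" and "length D = N"
  shows "((\<exists>A \<in> carrier_mat N N. has_eigenvalue_seq A \<Lambda> \<and> diag_mat A = D)
            \<longleftrightarrow> sum_list \<Lambda> = sum_list D)
    \<and> (sum_list \<Lambda> = sum_list D \<longrightarrow>
         (\<exists>L \<in> carrier_mat N N. \<exists>Linv \<in> carrier_mat N N.
            unit_lower_triangular L \<and> inverts_mat L Linv \<and> inverts_mat Linv L \<and>
            diag_mat (Linv * T_mat \<Lambda> * L) = D))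
    \<and> (sum_list \<Lambda> = sum_list D \<longrightarrow> set \<Lambda> \<subseteq> \<real> \<longrightarrow> set D \<subseteq> \<real> \<longrightarrow>
         (\<exists>L \<in> carrier_mat N N. \<exists>Linv \<in> carrier_mat N N.
            unit_lower_triangular L \<and> elements_mat L \<subseteq> \<real> \<and>
            inverts_mat L Linv \<and> inverts_mat Linv L \<and>
            diag_mat (Linv * T_mat \<Lambda> * L) = D))"
proof -
  note len = assms(2,3)
  define c where "c = (\<lambda>j. \<Sum>k\<le>j. D ! k - \<Lambda> ! k)"
  define L where "L = lower_bidiag N c"
  define K where "K = lower_bidiag_inv N c"
  have carr: "L \<in> carrier_mat N N" "K \<in> carrier_mat N N"
    by (simp_all add: L_def K_def)
  have LK: "L * K = 1\<^sub>m N" and KL: "K * L = 1\<^sub>m N"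
    by (simp_all add: L_def K_def lower_bidiag_mult_inv lower_bidiag_inv_mult)
  then have inv: "inverts_mat L K" "inverts_mat K L"
    using carr by (simp_all add: inverts_mat_def)
  have ult: "unit_lower_triangular L"
    by (simp add: L_def unit_lower_triangular_lower_bidiag)
  have diag: "diag_mat (K * T_mat \<Lambda> * L) = D" if "sum_list \<Lambda> = sum_list D"
    using conj_T_mat_partial_sums[OF len that] by (simp add: L_def K_def c_def)
  have T: "T_mat \<Lambda> \<in> carrier_mat N N"
    using len by (simp add: T_mat_carrier)
  \<comment> \<open>The conjugate is also the witness \<open>A\<close> for sufficiency: similarity
    transports the characteristic polynomial of \<open>T_mat \<Lambda>\<close> to it.\<close>
  have "similar_mat (K * T_mat \<Lambda> * L) (T_mat \<Lambda>)"
    using carr T LK KL by (intro similar_matI[of _ _ K L N]) auto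
  then have eig: "has_eigenvalue_seq (K * T_mat \<Lambda> * L) \<Lambda>"
    using has_eigenvalue_seq_T_mat[of \<Lambda>] by (simp add: has_eigenvalue_seq_def char_poly_similar)
  have real: "elements_mat L \<subseteq> \<real>" if "set \<Lambda> \<subseteq> \<real>" "set D \<subseteq> \<real>"
  proof -
    \<comment> \<open>The entries of \<open>L\<close> are 0, 1 and values of \<open>c\<close>, and
      the latter are sums of differences of real numbers.\<close>
    have "c j \<in> \<real>" if "j < N" for j
      unfolding c_def using that \<open>set \<Lambda> \<subseteq> \<real>\<close> \<open>set D \<subseteq> \<real>\<close> len
      by (intro sum_in_Reals Reals_diff) (auto simp: subset_iff)
    then show ?thesis
      by (auto simp: L_def lower_bidiag_def dest!: elements_matD)
  qed
  have "K * T_mat \<Lambda> * L \<in> carrier_mat N N"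
    using carr T by auto
  then have "(\<exists>A \<in> carrier_mat N N. has_eigenvalue_seq A \<Lambda> \<and> diag_mat A = D)
      \<longleftrightarrow> sum_list \<Lambda> = sum_list D"
    using eig diag sum_list_diag_eq_eigenvalues by metis
  then show ?thesis
    using carr ult inv diag real by blast
qed

end
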